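(* Fix a trading window $t$ with nonempty seller coalition $\Phi_s^t$ and buyer coalition $\Phi_b^t$, and let $\mathcal{G}$ be the energy trading game between $\Phi_b^t$ (leader, choosing the price $p^t\in[p_l,p_h]$) and the sellers in $\Phi_s^t$ (followers, each choosing its load $l_i^t$), with seller utilities $U_i^t$ and buyer-coalition total cost $\Gamma^t$. Then an equilibrium $(\{l_i^{t*}\}_{H_i\in\Phi_s^t},p^{t*})$ of $\mathcal{G}$ exists and is unique.
   Context: Agents: each agent $H_i$ in trading window $t$ has generation $g_i^t$, load $l_i^t$, battery charging amount $b_i^t$ (positive if charging, negative if discharging, $0$ if there is no battery), and net energy $sn_i^t=g_i^t-l_i^t-b_i^t$. Sellers $\Phi_s^t$ are the agents with $sn_i^t>0$; buyers $\Phi_b^t$ are those with $sn_j^t<0$. Market supply and demand: $E_s^t=\sum_{H_i\in\Phi_s^t}sn_i^t$, $E_b^t=\sum_{H_j\in\Phi_b^t}|sn_j^t|$. Prices: $ps_g^t$ is the main grid's retail price, $pb_g^t$ the price at which the main grid buys energy, and $0<pb_g^t<p_l\le p_h<ps_g^t$, where $[p_l,p_h]$ is the allowed range of the market price $p^t$. Seller utility: $U_i^t=k_i^t\log(1+l_i^t+\epsilon_i^t b_i^t)+p^t(g_i^t-l_i^t-b_i^t)$, where $k_i^t>0$ is a preference parameter and $\epsilon_i^t\in(0,1)$ is the battery loss coefficient. Buyer-coalition total cost: $\Gamma^t=p^tE_s^t+ps_g^t(E_b^t-E_s^t)$, where $E_s^t=\sum_{H_i\in\Phi_s^t}(g_i^t-l_i^t-b_i^t)$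 depends on the sellers' loads. Game $\mathcal{G}$: the quantities $g_i^t,b_i^t,k_i^t,\epsilon_i^t$, the buyers' data, and $ps_g^t,p_l,p_h$ are fixed parameters. The strategy of seller $H_i$ is its load $l_i^t$ (any real number with $1+l_i^t+\epsilon_i^tb_i^t>0$); the strategy of the buyer coalition is the price $p^t\in[p_l,p_h]$. Sellers want to maximize their utilities and the buyer coalition wants to minimize $\Gamma^t$. Equilibrium: a strategy tuple $(\{l_i^{t*}\}_{H_i\in\Phi_s^t},p^{t*})$ with $p_l\le p^{t*}\le p_h$ is an equilibrium of $\mathcal{G}$ if and only if (i) for every seller $H_k\in\Phi_s^t$ and every alternative load $l_k^t$, $U_k^t(\{l_i^{t*}\}_{H_i\in\Phi_s^t},p^{t*})\ge U_k^t(\{l_k^t,\{l_i^{t*}\}_{H_i\in\Phi_s^t,\,i\ne k}\},p^{t*})$; and (ii) for every price $p\in[p_l,p_h]$, $\Gamma^t(\{l_i^{t*}\}_{H_i\in\Phi_s^t},p^{t*})\le\Gamma^t(\{l_i^{t*}\}_{H_i\in\Phi_s^t},p)$. *)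

theory Defs
  imports Complex_Main "HOL-Library.FuncSet"
begin

text \<open>
  The data of a single trading window. The field \<open>load\<close> holds the loads that determine who
  sells and who buys in the window; in the game, the sellers' loads are replaced by strategies.
\<close>

record 'a window =
  agents :: "'a set"
  gen :: "'a \<Rightarrow> real"
  load :: "'a \<Rightarrow> real"
  battery :: "'a \<Rightarrow> real"
  pref :: "'a \<Rightarrow> real"
  loss :: "'a \<Rightarrow> real"
  grid_sell :: real  \<comment> \<open>\<open>ps\<^sub>g\<close>, the retail price of the main grid\<close>
  grid_buy :: real   \<comment> \<open>\<open>pb\<^sub>g\<close>, the price at which the main grid buys\<close>
  p_low :: real
  p_high :: real

text \<open>Net energy when the loads are given by \<open>l\<close>.\<close>

definition net_energy :: "'a window \<Rightarrow> ('a \<Rightarrow> real) \<Rightarrow> 'a \<Rightarrow> real" where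
  "net_energy W l i = gen W i - l i - battery W i"

definition sellers :: "'a window \<Rightarrow> 'a set" where
  "sellers W = {i \<in> agents W. net_energy W (load W) i > 0}"

definition buyers :: "'a window \<Rightarrow> 'a set" where
  "buyers W = {i \<in> agents W. net_energy W (load W) i < 0}"

text \<open>
  The set of sellers is fixed by the window, while the supply varies with the sellers'
  strategies \<open>l\<close>. The demand uses the fixed data of the buyers.
\<close>

definition market_supply :: "'a window \<Rightarrow> ('a \<Rightarrow> real) \<Rightarrow> real" where
  "market_supply W l = (\<Sum>i\<in>sellers W. net_energy W l i)"

definition market_demand :: "'a window \<Rightarrow> real" where
  "market_demand W = (\<Sum>j\<in>buyers W. \<bar>net_energy W (load W) j\<bar>)"

definition seller_utility :: "'a window \<Rightarrow> 'a \<Rightarrow> ('a \<Rightarrow> real) \<Rightarrow> real \<Rightarrow> real" where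
  "seller_utility W i l p =
     pref W i * ln (1 + l i + loss W i * battery W i) + p * (gen W i - l i - battery W i)"

definition buyer_cost :: "'a window \<Rightarrow> ('a \<Rightarrow> real) \<Rightarrow> real \<Rightarrow> real" where
  "buyer_cost W l p = p * market_supply W l + grid_sell W * (market_demand W - market_supply W l)"

definition load_strategies :: "'a window \<Rightarrow> 'a \<Rightarrow> real set" where
  "load_strategies W i = {x. 1 + x + loss W i * battery W i > 0}"

definition price_strategies :: "'a window \<Rightarrow> real set" where
  "price_strategies W = {p_low W..p_high W}"

text \<open>
  A load profile is a family indexed by the sellers only. Taking it from the extensional
  product makes equality of functions agree with equality of such families, as needed for
  uniqueness.
\<close>

definition is_equilibrium :: "'a window \<Rightarrow> ('a \<Rightarrow> real) \<times> real \<Rightarrow> bool" where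
  "is_equilibrium W = (\<lambda>(l, p).
     l \<in> (\<Pi>\<^sub>E i\<in>sellers W. load_strategies W i) \<and> p \<in> price_strategies W \<and>
     (\<forall>i\<in>sellers W. \<forall>x\<in>load_strategies W i.
        seller_utility W i l p \<ge> seller_utility W i (l(i := x)) p) \<and>
     (\<forall>q\<in>price_strategies W. buyer_cost W l p \<le> buyer_cost W l q))"

end

theory Submission
  imports Defs
begin

text \<open>
  At a price \<open>p > 0\<close> the strictly concave utility of seller \<open>i\<close> has the unique maximiser
  \<open>k\<^sub>i / p - 1 - \<epsilon>\<^sub>i b\<^sub>i\<close>, so the supply answering \<open>p\<close> is \<open>S p = C - K / p\<close> with \<open>K > 0\<close>, which is
  continuous and strictly increasing. The buyers' cost is affine in the price with slope the
  supply, hence \<open>p\<close> belongs to an equilibrium iff it minimises \<open>q * S p\<close> over \<open>q\<close> in the price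
  range: \<open>S p > 0\<close> forces the lowest price, \<open>S p < 0\<close> the highest one, and \<open>S p = 0\<close> allows any
  price. As \<open>S\<close> is increasing, exactly one price satisfies this.
\<close>

text \<open>With \<open>t\<close> the ratio of \<open>y\<close> to \<open>k / p\<close>, the gap to
  the maximum is \<open>k * (t - 1 - ln t)\<close>. It is nonnegative since
  \<open>ln t <= t - 1\<close>, and it vanishes only at \<open>t = 1\<close>.\<close>

lemma log_minus_linear_le:
  fixes k p y :: real
  assumes "k > 0" "p > 0" "y > 0"
  shows "k * ln y - p * y \<le> k * ln (k / p) - p * (k / p)"
    and "k * ln y - p * y = k * ln (k / p) - p * (k / p) \<Longrightarrow> y = k / p"
proof -
  define t where "t = p * y / k"
  have t: "t > 0" and y: "y = k / p * t"
    using assms by (simp_all add: t_def)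
  have eq: "k * ln (k / p) - p * (k / p) - (k * ln y - p * y) = k * (t - 1 - ln t)"
  proof -
    have "ln y = ln (k / p) + ln t"
      unfolding y by (rule ln_mult_pos) (use assms t in simp_all)
    moreover have "p * y = k * t" "p * (k / p) = k"
      using assms by (simp_all add: y)
    ultimately show ?thesis
      by (simp add: algebra_simps)
  qed
  have "k * (t - 1 - ln t) \<ge> 0"
    using assms ln_le_minus_one[OF t] by simp
  with eq show "k * ln y - p * y \<le> k * ln (k / p) - p * (k / p)"
    by linarith
  show "y = k / p" if "k * ln y - p * y = k * ln (k / p) - p * (k / p)"
  proof -
    have "k * (t - 1 - ln t) = 0"
      using eq that by linarith
    then have "ln t = t - 1"
      using assms by simp
    then show ?thesis
      using ln_eq_minus_one[OF t] y by simp
  qed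
qed

text \<open>A fixed-point condition: \<open>q\<close> varies while the supply stays frozen at
  \<open>S p\<close>, so only the sign of \<open>S p\<close> matters. If \<open>p < q\<close> both
  qualified, testing each against the other would give \<open>S p >= 0 >= S q\<close>, against
  monotonicity.\<close>

lemma clearing_price_unique:
  fixes S :: "real \<Rightarrow> real"
  assumes "a \<le> b" and cont: "continuous_on {a..b} S" and mono: "strict_mono_on {a..b} S"
  shows "\<exists>!p. p \<in> {a..b} \<and> (\<forall>q\<in>{a..b}. p * S p \<le> q * S p)"
proof (rule ex_ex1I)
  \<comment> \<open>The witnesses are \<open>a\<close>, \<open>b\<close> and a zero of
    \<open>S\<close>, respectively; the cases overlap harmlessly.\<close>
  consider "S a \<ge> 0" | "S b \<le> 0" | "S a \<le> 0" "0 \<le> S b"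
    by linarith
  then show "\<exists>p. p \<in> {a..b} \<and> (\<forall>q\<in>{a..b}. p * S p \<le> q * S p)"
  proof cases
    case 1
    then show ?thesis
      using \<open>a \<le> b\<close> by (intro exI[of _ a]) (auto intro: mult_right_mono)
  next
    case 2
    then show ?thesis
      using \<open>a \<le> b\<close> by (intro exI[of _ b]) (auto intro: mult_right_mono_neg)
  next
    case 3
    then obtain p where "a \<le> p" "p \<le> b" "S p = 0"
      using IVT'[OF _ _ \<open>a \<le> b\<close> cont] by blast
    then show ?thesis
      by auto
  qed
next
  have no_two: False
    if p: "p \<in> {a..b}" "\<forall>r\<in>{a..b}. p * S p \<le> r * S p"
      and q: "q \<in> {a..b}" "\<forall>r\<in>{a..b}. q * S q \<le> r * S q" and "p < q" for p q
  proof -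
    have "p * S p \<le> q * S p" "q * S q \<le> p * S q"
      using p q by auto
    then have "S p \<ge> 0" "S q \<le> 0"
      using \<open>p < q\<close> by (auto simp: mult_le_cancel_right)
    moreover have "S p < S q"
      using strict_mono_onD[OF mono p(1) q(1) \<open>p < q\<close>] .
    ultimately show False
      by linarith
  qed
  show "p = q"
    if "p \<in> {a..b} \<and> (\<forall>r\<in>{a..b}. p * S p \<le> r * S p)"
      and "q \<in> {a..b} \<and> (\<forall>r\<in>{a..b}. q * S q \<le> r * S q)" for p q
    using no_two that by (metis linorder_neqE_linordered_idom)
qed

text \<open>Root \<open>l\<close> of the first-order condition
  \<open>pref W i / (1 + l + loss W i * battery W i) = p\<close>.\<close>

definition best_load :: "'a window \<Rightarrow> real \<Rightarrow> 'a \<Rightarrow> real" where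
  "best_load W p i = pref W i / p - 1 - loss W i * battery W i"

lemma best_load_strategy:
  assumes "pref W i > 0" "p > 0"
  shows "best_load W p i \<in> load_strategies W i"
  using assms by (simp add: best_load_def load_strategies_def)

text \<open>A seller's utility depends on its own load only, so the best response is a one-variable
  problem, whatever the other sellers do.\<close>

lemma seller_best_response_iff:
  assumes "pref W i > 0" "p > 0" "l i \<in> load_strategies W i"
  shows "(\<forall>x\<in>load_strategies W i. seller_utility W i (l(i := x)) p \<le> seller_utility W i l p)
    \<longleftrightarrow> l i = best_load W p i"
proof -
  let ?k = "pref W i" and ?c = "1 + loss W i * battery W i"
  define u where "u y = ?k * ln y - p * y" for y
  \<comment> \<open>Shifting the load by \<open>?c\<close> leaves \<open>u\<close> plus a term free
    of the load, so utilities compare as values of \<open>u\<close>.\<close>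
  have util: "seller_utility W i f p = u (f i + ?c) + p * (gen W i - battery W i + ?c)" for f
    by (simp add: seller_utility_def u_def algebra_simps)
  have best: "best_load W p i + ?c = ?k / p"
    by (simp add: best_load_def)
  have pos: "x + ?c > 0" if "x \<in> load_strategies W i" for x
    using that by (simp add: load_strategies_def algebra_simps)
  have max: "u (x + ?c) \<le> u (?k / p)" if "x \<in> load_strategies W i" for x
    unfolding u_def using log_minus_linear_le(1) assms pos[OF that] by blast
  have unique: "x + ?c = ?k / p"
    if "x \<in> load_strategies W i" "u (x + ?c) = u (?k / p)" for x
    using log_minus_linear_le(2)[OF assms(1,2) pos[OF that(1)]] that(2) unfolding u_def by blast
  have "(\<forall>x\<in>load_strategies W i. u (x + ?c) \<le> u (l i + ?c)) \<longleftrightarrow> l i = best_load W p i"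
  proof
    assume "\<forall>x\<in>load_strategies W i. u (x + ?c) \<le> u (l i + ?c)"
    then have "u (?k / p) \<le> u (l i + ?c)"
      using best_load_strategy[OF assms(1,2)] best by metis
    then have "l i + ?c = ?k / p"
      using max unique assms(3) by (metis order_antisym)
    then show "l i = best_load W p i"
      using best by linarith
  next
    assume "l i = best_load W p i"
    then show "\<forall>x\<in>load_strategies W i. u (x + ?c) \<le> u (l i + ?c)"
      using best max by metis
  qed
  then show ?thesis
    by (simp add: util)
qed

text \<open>The price determines the loads through the best responses. In the buyers' condition the
  loads are held fixed, so the \<open>grid_sell\<close> term is the same on both sides and
  cancels.\<close>

lemma is_equilibrium_iff:
  assumes pref: "\<And>i. i \<in> sellers W \<Longrightarrow> pref W i > 0" and "0 < p_low W"
  shows "is_equilibrium W (l, p) \<longleftrightarrow>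
    l = restrict (best_load W p) (sellers W) \<and> p \<in> {p_low W..p_high W} \<and>
    (\<forall>q\<in>{p_low W..p_high W}.
       p * market_supply W (best_load W p) \<le> q * market_supply W (best_load W p))"
\<comment> \<open>Membership in the price range supplies \<open>p > 0\<close>, on which the best
  responses rest.\<close>
proof (cases "p \<in> {p_low W..p_high W}")
  case True
  then have "p > 0"
    using \<open>0 < p_low W\<close> by simp
  have "l \<in> (\<Pi>\<^sub>E i\<in>sellers W. load_strategies W i) \<and>
      (\<forall>i\<in>sellers W. \<forall>x\<in>load_strategies W i.
         seller_utility W i (l(i := x)) p \<le> seller_utility W i l p)
    \<longleftrightarrow> l = restrict (best_load W p) (sellers W)" (is "?L \<longleftrightarrow> ?R")
  proof
    assume L: ?L
    then have "l i = best_load W p i" if "i \<in> sellers W" for i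
      using that seller_best_response_iff[OF pref \<open>p > 0\<close>] by (blast dest: PiE_mem)
    \<comment> \<open>Off the sellers both functions are \<open>undefined\<close>, by extensionality
      of the profile.\<close>
    then show ?R
      using L by (intro ext) (auto simp: PiE_def extensional_def)
  next
    assume R: ?R
    then have "l \<in> (\<Pi>\<^sub>E i\<in>sellers W. load_strategies W i)"
      using best_load_strategy[OF pref \<open>p > 0\<close>] by auto
    moreover have "\<forall>x\<in>load_strategies W i.
        seller_utility W i (l(i := x)) p \<le> seller_utility W i l p" if "i \<in> sellers W" for i
      using seller_best_response_iff[OF pref[OF that] \<open>p > 0\<close>, of l] that R
        best_load_strategy[OF pref[OF that] \<open>p > 0\<close>] by simp
    ultimately show ?L
      by blast
  qed
  moreover have "market_supply W (restrict (best_load W p) (sellers W)) =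
      market_supply W (best_load W p)"
    by (simp add: market_supply_def net_energy_def)
  ultimately show ?thesis
    using True by (auto simp: is_equilibrium_def price_strategies_def buyer_cost_def)
next
  case False
  then show ?thesis
    by (auto simp: is_equilibrium_def price_strategies_def)
qed

theorem lemma1:
  fixes W :: "'a window"
  assumes "finite (agents W)"
    and "sellers W \<noteq> {}"
    and "\<And>i. i \<in> sellers W \<Longrightarrow> pref W i > 0"
    and "\<And>i. i \<in> sellers W \<Longrightarrow> 0 < loss W i \<and> loss W i < 1"
    and "0 < grid_buy W" and "grid_buy W < p_low W"
    and "p_low W \<le> p_high W" and "p_high W < grid_sell W"
  shows "\<exists>!lp. is_equilibrium W lp"
proof -
  define S where "S p = market_supply W (best_load W p)" for p
  let ?P = "{p_low W..p_high W}"
  have pos: "0 < p_low W"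
    using assms(5,6) by linarith
  have fin: "finite (sellers W)"
    using assms(1) by (simp add: sellers_def)
  have S: "S p = (\<Sum>i\<in>sellers W. gen W i - (pref W i / p - 1 - loss W i * battery W i) - battery W i)"
    for p by (simp add: S_def market_supply_def net_energy_def best_load_def)
  have "continuous_on ?P S"
    unfolding S using pos by (auto intro!: continuous_intros)
  \<comment> \<open>Raising the price lowers every \<open>pref W i / p\<close> and so raises every
    summand; the sum rises strictly because the seller set is finite and nonempty.\<close>
  moreover have "strict_mono_on ?P S"
  proof (rule strict_mono_onI)
    fix p q assume "p \<in> ?P" "q \<in> ?P" "p < q"
    then show "S p < S q"
      unfolding S using pos fin assms(2,3)
      by (intro sum_strict_mono) (auto intro!: divide_strict_left_mono)
  qed
  ultimately obtain p where p: "p \<in> ?P \<and> (\<forall>q\<in>?P. p * S p \<le> q * S p)"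
    and unique: "\<And>r. r \<in> ?P \<and> (\<forall>q\<in>?P. r * S r \<le> q * S r) \<Longrightarrow> r = p"
    using clearing_price_unique[OF assms(7)] by metis
  have iff: "is_equilibrium W (l, r) \<longleftrightarrow> l = restrict (best_load W r) (sellers W) \<and>
      r \<in> ?P \<and> (\<forall>q\<in>?P. r * S r \<le> q * S r)" for l r
    unfolding S_def by (rule is_equilibrium_iff[OF assms(3) pos])
  show ?thesis
  proof (rule ex1I)
    show "is_equilibrium W (restrict (best_load W p) (sellers W), p)"
      using iff p by blast
    show "lp = (restrict (best_load W p) (sellers W), p)" if "is_equilibrium W lp" for lp
      using that iff unique by (cases lp) blast
  qed
qed

end
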